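(* Let $G$ be a finite simple graph whose complement $\overline{G}$ is connected and satisfies $\operatorname{diam}(\overline{G})\geq 4$. Then $pc_{1,2}(G)\leq 3$.
   Context: All graphs are finite, undirected and simple. An edge-coloring is an arbitrary map from the edge set to a set of colors (adjacent edges may receive the same color). In an edge-colored graph, a path $P$ is a distance $2$-proper path if no two edges of $P$ of the same color appear with fewer than $2$ edges in between on $P$; equivalently, any two distinct edges of $P$ that are consecutive on $P$ or separated by exactly one edge of $P$ have different colors. The $(1,2)$-proper connection number $pc_{1,2}(G)$ is the minimum number of colors in an edge-coloring of $G$ such that every two distinct vertices of $G$ are joined by a distance $2$-proper path in $G$. The inequality $pc_{1,2}(G)\leq 3$ means that such a coloring with at most $3$ colors exists (in particular that $G$ is connected). *)

theory Defs
  imports "Graph_Theory.Graph_Theory" "HOL-Library.Extended_Nat"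
begin

text \<open>
  Finite simple graphs are rendered by the locale \<^locale>\<open>pair_graph\<close>: every edge is a pair of
  opposite arcs. An edge-coloring must not distinguish these two arcs, so it is a function on the
  undirected edges, the two-element sets \<open>{u, v}\<close>.
\<close>

definition complement :: "'a pair_pre_digraph \<Rightarrow> 'a pair_pre_digraph" where
  "complement G =
     \<lparr> pverts = pverts G,
       parcs = {(u, v). u \<in> pverts G \<and> v \<in> pverts G \<and> u \<noteq> v \<and> (u, v) \<notin> parcs G} \<rparr>"

lemma pair_graph_complement:
  assumes "pair_graph G"
  shows "pair_graph (complement G)"
proof -
  interpret pair_graph G by fact
  have sym: "(u, v) \<in> parcs G \<longleftrightarrow> (v, u) \<in> parcs G" for u v
    using pair_sym_arcs by (auto simp: symmetric_def sym_def)
  have "finite (parcs (complement G))"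
    by (rule finite_subset[of _ "pverts G \<times> pverts G"]) (auto simp: complement_def)
  then show ?thesis
    using sym by unfold_locales (auto simp: complement_def symmetric_def sym_def)
qed

text \<open>
  With unit weights the cost of a walk is its length, so \<^const>\<open>wf_digraph.\<mu>\<close> is the usual
  distance, with value \<open>\<infinity>\<close> between different components.
\<close>

definition diameter :: "'a pair_pre_digraph \<Rightarrow> ereal" where
  "diameter G = (SUP (u, v) \<in> pverts G \<times> pverts G. wf_digraph.\<mu> G (\<lambda>_. 1) u v)"

definition edge_set :: "'a pair_pre_digraph \<Rightarrow> 'a set set" where
  "edge_set G = {{u, v} |u v. (u, v) \<in> parcs G}"

definition edge_color :: "('a set \<Rightarrow> 'c) \<Rightarrow> 'a \<times> 'a \<Rightarrow> 'c" where
  "edge_color c e = c {fst e, snd e}"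

text \<open>
  Between the edges at positions \<open>i < j\<close> of a path there are \<open>j - i - 1\<close> further edges.
\<close>

definition distance2_proper :: "('a set \<Rightarrow> 'c) \<Rightarrow> ('a \<times> 'a) list \<Rightarrow> bool" where
  "distance2_proper c p \<longleftrightarrow>
     (\<forall>i j. i < j \<and> j < length p \<and> j - i - 1 < 2 \<longrightarrow> edge_color c (p ! i) \<noteq> edge_color c (p ! j))"

definition proper_connected_coloring :: "'a pair_pre_digraph \<Rightarrow> ('a set \<Rightarrow> 'c) \<Rightarrow> bool" where
  "proper_connected_coloring G c \<longleftrightarrow>
     (\<forall>u \<in> pverts G. \<forall>v \<in> pverts G. u \<noteq> v \<longrightarrow>
        (\<exists>p. pre_digraph.apath G u p v \<and> distance2_proper c p))"

text \<open>
  The colors of a finite graph can be taken to be natural numbers. If no coloring is suitable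
  (\<open>G\<close> is disconnected), the infimum is that of the empty set, \<open>\<infinity>\<close>; otherwise it is attained.
\<close>

definition pc12 :: "'a pair_pre_digraph \<Rightarrow> enat" where
  "pc12 G = (INF c \<in> {c :: 'a set \<Rightarrow> nat. proper_connected_coloring G c}.
               enat (card (c ` edge_set G)))"

end

theory Submission
  imports Defs
begin

text \<open>
  Split the vertices into the distance layers \<open>A\<^sub>0 = {x}, A\<^sub>1, \<dots>, A\<^sub>4\<close> of the complement, where \<open>A\<^sub>4\<close>
  collects all distances at least 4. In \<open>G\<close> two layers whose indices differ by at least 2 are
  completely joined. Fix \<open>a \<in> A\<^sub>1\<close> and color the edges \<open>A\<^sub>0A\<^sub>2\<close> with 2, the edges \<open>A\<^sub>2A\<^sub>4\<close> with 3,
  the edges between \<open>A\<^sub>1\<close> and \<open>A\<^sub>3\<close> with 2 if they contain \<open>a\<close> and with 3 otherwise, and every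
  other edge with 1. Pairs in the same layer or in consecutive layers, the only ones that can be
  nonadjacent, are then joined by paths through \<open>x\<close>, \<open>a\<close> and fixed vertices of \<open>A\<^sub>2\<close>, \<open>A\<^sub>3\<close> and \<open>A\<^sub>4\<close>.
\<close>

section \<open>Distance 2-proper lists of arcs\<close>

lemma distance2_proper_Nil [simp]: "distance2_proper c []"
  by (simp add: distance2_proper_def)

text \<open>For \<open>i < j\<close> the bound \<open>j - i - 1 < 2\<close> leaves only
  \<open>j - i\<close> equal to 1 or 2, so a new first edge competes with the next two alone. As a
  simp rule this checks explicit paths edge by edge.\<close>

lemma distance2_proper_Cons [simp]:
  "distance2_proper c (e # p) \<longleftrightarrow>
     (\<forall>f \<in> set (take 2 p). edge_color c e \<noteq> edge_color c f) \<and> distance2_proper c p"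
    (is "?L \<longleftrightarrow> ?R")
proof
  assume L: ?L
  have "edge_color c e \<noteq> edge_color c (p ! k)" if "k < 2" "k < length p" for k
    using L[unfolded distance2_proper_def, rule_format, of 0 "Suc k"] that by simp
  moreover have "distance2_proper c p"
    unfolding distance2_proper_def
  proof (intro allI impI)
    fix i j assume "i < j \<and> j < length p \<and> j - i - 1 < 2"
    then show "edge_color c (p ! i) \<noteq> edge_color c (p ! j)"
      using L[unfolded distance2_proper_def, rule_format, of "Suc i" "Suc j"] by simp
  qed
  ultimately show ?R
    by (fastforce simp: in_set_conv_nth)
next
  assume R: ?R
  show ?L
    unfolding distance2_proper_def
  proof (intro allI impI)
    fix i j assume ij: "i < j \<and> j < length (e # p) \<and> j - i - 1 < 2"
    then obtain j' where j: "j = Suc j'"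
      by (cases j) auto
    show "edge_color c ((e # p) ! i) \<noteq> edge_color c ((e # p) ! j)"
    proof (cases i)
      case 0
      then have "p ! j' \<in> set (take 2 p)"
        using ij j by (auto simp: in_set_conv_nth intro!: exI[of _ j'])
      then show ?thesis
        using R 0 j by simp
    next
      case (Suc i')
      then show ?thesis
        using R ij j by (auto simp: distance2_proper_def)
    qed
  qed
qed

lemma rev_path_conv: "rev_path p = rev (map prod.swap p)"
  by (induction p) (auto simp: prod.swap_def)

lemma distance2_proper_rev_path:
  assumes "distance2_proper c p"
  shows "distance2_proper c (rev_path p)"
  unfolding distance2_proper_def rev_path_conv
proof (intro allI impI)
  fix i j
  let ?q = "rev (map prod.swap p)" and ?n = "length p"
  assume ij: "i < j \<and> j < length ?q \<and> j - i - 1 < 2"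
  have swap: "edge_color c (prod.swap e) = edge_color c e" for e :: "'a \<times> 'a"
    by (simp add: edge_color_def insert_commute)
  have "edge_color c (p ! (?n - Suc j)) \<noteq> edge_color c (p ! (?n - Suc i))"
    using ij by (intro assms[unfolded distance2_proper_def, rule_format]) auto
  moreover have "?n - Suc i < ?n" "?n - Suc j < ?n"
    using ij by auto
  ultimately show "edge_color c (?q ! i) \<noteq> edge_color c (?q ! j)"
    using ij by (simp add: rev_nth swap)
qed

section \<open>The coloring by layers\<close>

lemma (in pair_graph) pair_sym: "(u, v) \<in> parcs G \<longleftrightarrow> (v, u) \<in> parcs G"
  using pair_sym_arcs by (auto simp: symmetric_def sym_def)

text \<open>The image of an edge under \<open>L\<close> is the unordered pair of its layers, a
  singleton for an edge within one layer.\<close>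

definition layer_coloring :: "('a \<Rightarrow> nat) \<Rightarrow> 'a \<Rightarrow> 'a set \<Rightarrow> nat" where
  "layer_coloring L a e =
     (if L ` e = {0, 2} then 2
      else if L ` e = {2, 4} then 3
      else if L ` e = {1, 3} then (if a \<in> e then 2 else 3)
      else 1)"

text \<open>Every path below uses only edges supplied by \<open>apart\<close>, so edges within a
  layer or between consecutive layers may be present or absent.\<close>

lemma (in pair_graph) layer_coloring_proper_connected:
  assumes le4: "\<And>u. u \<in> pverts G \<Longrightarrow> L u \<le> 4"
    and nonempty: "\<And>i. i \<le> 4 \<Longrightarrow> \<exists>u \<in> pverts G. L u = i"
    and apart: "\<And>u v. u \<in> pverts G \<Longrightarrow> v \<in> pverts G \<Longrightarrow> L u + 2 \<le> L v \<Longrightarrow> (u, v) \<in> parcs G"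
    and root: "\<And>u v. u \<in> pverts G \<Longrightarrow> v \<in> pverts G \<Longrightarrow> L u = 0 \<Longrightarrow> L v = 0 \<Longrightarrow> u = v"
    and a: "a \<in> pverts G" "L a = 1"
  shows "proper_connected_coloring G (layer_coloring L a)"
proof -
  let ?c = "layer_coloring L a"
  let ?P = "\<lambda>u v. \<exists>p. apath u p v \<and> distance2_proper ?c p"
  obtain x where x: "x \<in> pverts G" "L x = 0" using nonempty[of 0] by auto
  obtain b where b: "b \<in> pverts G" "L b = 2" using nonempty[of 2] by auto
  obtain c where c: "c \<in> pverts G" "L c = 3" using nonempty[of 3] by auto
  obtain d where d: "d \<in> pverts G" "L d = 4" using nonempty[of 4] by auto
  have far: "(u, v) \<in> parcs G \<and> (v, u) \<in> parcs G"
    if "u \<in> pverts G" "v \<in> pverts G" "L u + 2 \<le> L v" for u v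
    using apart[OF that] pair_sym by blast
  note simps = apath_def awalk_Cons_iff awalk_Nil_iff edge_color_def
    layer_coloring_def doubleton_eq_iff
  have sym: "?P v u" if "?P u v" for u v
    using that apath_rev_path[of v _ u] distance2_proper_rev_path by blast
  have path: "?P u v"
    if uv: "u \<in> pverts G" "v \<in> pverts G" "u \<noteq> v" "L u \<le> L v" for u v
  proof (cases "L u + 2 \<le> L v")
    case True
    then have "apath u [(u, v)] v"
      using uv far by (auto simp: simps)
    then show ?thesis
      by (intro exI[of _ "[(u, v)]"]) simp
  next
    case False
    have "L v \<le> 4" using le4 uv by auto
    then have "L u \<in> {0, 1, 2, 3, 4}" "L v = L u \<or> L v = Suc (L u)"
      using False uv(4) by auto
    then consider "L u = 0" "L v = 0" | "L u = 0" "L v = 1" | "L u = 1" "L v = 1" | "L u = 1" "L v = 2"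
      | "L u = 2" "L v = 2" | "L u = 2" "L v = 3" | "L u = 3" "L v = 3" | "L u = 3" "L v = 4"
      | "L u = 4" "L v = 4"
      using \<open>L v \<le> 4\<close> by (elim insertE emptyE disjE) auto
    then show ?thesis
    proof cases
      case 1
      then show ?thesis using root uv by blast
    next
      case 2
      then show ?thesis
        using uv c far[of u c] far[of v c]
        by (intro exI[of _ "[(u, c), (c, v)]"]) (auto simp: simps)
    next
      case 3
      \<comment> \<open>The last edge must have color 3, so the path has to be oriented to end outside \<open>a\<close>.\<close>
      have *: "?P u v" if "u \<in> pverts G" "v \<in> pverts G" "u \<noteq> v" "L u = 1" "L v = 1" "v \<noteq> a" for u v
        using that a b c d x far[of u d] far[of b d] far[of x b] far[of x c] far[of v c]
        by (intro exI[of _ "[(u, d), (d, b), (b, x), (x, c), (c, v)]"]) (auto simp: simps)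
      show ?thesis
        using *[of u v] *[of v u] sym uv 3 by metis
    next
      case 4
      then show ?thesis
        using uv d far[of u d] far[of v d]
        by (intro exI[of _ "[(u, d), (d, v)]"]) (auto simp: simps)
    next
      case 5
      then show ?thesis
        using uv x d far[of x u] far[of x d] far[of v d]
        by (intro exI[of _ "[(u, x), (x, d), (d, v)]"]) (auto simp: simps)
    next
      case 6
      then show ?thesis
        using uv x far[of x u] far[of x v]
        by (intro exI[of _ "[(u, x), (x, v)]"]) (auto simp: simps)
    next
      case 7
      \<comment> \<open>The colors are 1, 2, 3, 1, 2. Here the special role of \<open>a\<close>
        matters: with color 3 the last edge would clash with \<open>(b, d)\<close>, two positions
        earlier.\<close>
      then show ?thesis
        using uv x a b d far[of x u] far[of x b] far[of b d] far[of a d] far[of a v]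
        by (intro exI[of _ "[(u, x), (x, b), (b, d), (d, a), (a, v)]"]) (auto simp: simps)
    next
      case 8
      then show ?thesis
        using uv a far[of a u] far[of a v]
        by (intro exI[of _ "[(u, a), (a, v)]"]) (auto simp: simps)
    next
      case 9
      then show ?thesis
        using uv x b far[of x u] far[of x b] far[of b v]
        by (intro exI[of _ "[(u, x), (x, b), (b, v)]"]) (auto simp: simps)
    qed
  qed
  show ?thesis
    unfolding proper_connected_coloring_def
    \<comment> \<open>Reversing paths covers the pairs with \<open>L v \<le> L u\<close>.\<close>
    using path sym by (metis nat_le_linear)
qed

lemma layer_coloring_range: "layer_coloring L a e \<in> {1, 2, 3}"
  by (simp add: layer_coloring_def)

lemma pc12_le:
  fixes c :: "'a set \<Rightarrow> nat"
  assumes "proper_connected_coloring G c" and "card (c ` edge_set G) \<le> n"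
  shows "pc12 G \<le> enat n"
  unfolding pc12_def using assms by (intro INF_lower2[of c]) auto

section \<open>Distances as lengths of shortest walks\<close>

context wf_digraph
begin

text \<open>A natural-number version of \<open>\<mu>\<close> with unit weights. \<open>LEAST\<close>
  is unspecified when no walk exists, hence the reachability assumptions below.\<close>

definition walk_dist :: "'a \<Rightarrow> 'a \<Rightarrow> nat" where
  "walk_dist u v = (LEAST n. \<exists>p. awalk u p v \<and> length p = n)"

lemma walk_dist_le: "awalk u p v \<Longrightarrow> walk_dist u v \<le> length p"
  unfolding walk_dist_def by (rule Least_le) blast

lemma shortest_walk:
  assumes "u \<rightarrow>\<^sup>* v"
  obtains p where "awalk u p v" "length p = walk_dist u v"
proof -
  have "\<exists>n p. awalk u p v \<and> length p = n"
    using assms by (auto simp: reachable_awalk)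
  then have "\<exists>p. awalk u p v \<and> length p = walk_dist u v"
    unfolding walk_dist_def by (rule LeastI_ex)
  then show thesis using that by blast
qed

lemma walk_dist_eq_0:
  assumes "u \<rightarrow>\<^sup>* v" "walk_dist u v = 0"
  shows "u = v"
proof -
  obtain p where "awalk u p v" "length p = walk_dist u v"
    using shortest_walk assms(1) by blast
  then show ?thesis
    using assms(2) by (auto simp: awalk_Nil_iff)
qed

lemma walk_dist_arc:
  assumes "u \<rightarrow>\<^sup>* v" "e \<in> arcs G" "tail G e = v" "head G e = w"
  shows "walk_dist u w \<le> Suc (walk_dist u v)"
proof -
  obtain p where p: "awalk u p v" "length p = walk_dist u v"
    using shortest_walk assms(1) by blast
  moreover have "awalk v [e] w"
    using arc_implies_awalk assms by blast
  ultimately have "awalk u (p @ [e]) w"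
    using awalk_appendI p(1) by blast
  from walk_dist_le[OF this] show ?thesis
    using p(2) by simp
qed

text \<open>The vertex reached after \<open>k\<close> arcs of a shortest walk works: a shorter way
  to it, followed by the rest of the walk, would contradict minimality.\<close>

lemma walk_dist_intermediate:
  assumes "u \<rightarrow>\<^sup>* v" "k \<le> walk_dist u v"
  obtains w where "w \<in> verts G" "walk_dist u w = k"
proof -
  obtain p where p: "awalk u p v" "length p = walk_dist u v"
    using shortest_walk assms(1) by blast
  obtain w where w: "awalk u (take k p) w" "awalk w (drop k p) v"
    using p(1) awalk_append_iff[of u "take k p" "drop k p" v] by auto
  obtain q where q: "awalk u q w" "length q = walk_dist u w"
    using shortest_walk[OF reachable_awalkI[OF w(1)]] by blast
  have "awalk u (q @ drop k p) v"
    using q(1) w(2) by (rule awalk_appendI)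
  from walk_dist_le[OF this] have "k \<le> walk_dist u w"
    using p(2) q(2) assms(2) by simp
  moreover have "walk_dist u w \<le> k"
    using walk_dist_le[OF w(1)] by simp
  moreover have "w \<in> verts G"
    using w(1) by (rule awalk_last_in_verts)
  ultimately show thesis using that by simp
qed

lemma \<mu>_le_walk_dist:
  assumes "u \<rightarrow>\<^sup>* v"
  shows "\<mu> (\<lambda>_. 1) u v \<le> ereal (walk_dist u v)"
proof -
  obtain p where p: "awalk u p v" "length p = walk_dist u v"
    using shortest_walk assms by blast
  then have "awalk_cost (\<lambda>_. 1) p = walk_dist u v"
    by (simp add: awalk_cost_def sum_list_triv)
  then show ?thesis
    using min_cost_le_walk_cost[OF p(1), of "\<lambda>_. 1"] by simp
qed

end

text \<open>By contraposition: if all distances were at most \<open>n\<close>, so would be their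
  supremum. Attainment of the supremum thus need not be discussed.\<close>

lemma diameter_ge_walk_dist:
  assumes "pair_wf_digraph H" "\<And>u v. u \<in> pverts H \<Longrightarrow> v \<in> pverts H \<Longrightarrow> u \<rightarrow>\<^sup>*\<^bsub>with_proj H\<^esub> v"
    and "diameter H \<ge> ereal (Suc n)"
  obtains u v where "u \<in> pverts H" "v \<in> pverts H" "wf_digraph.walk_dist H u v \<ge> Suc n"
proof -
  interpret pair_wf_digraph H by fact
  have "\<not> (\<forall>u \<in> pverts H. \<forall>v \<in> pverts H. walk_dist u v \<le> n)"
  proof
    assume *: "\<forall>u \<in> pverts H. \<forall>v \<in> pverts H. walk_dist u v \<le> n"
    have "\<mu> (\<lambda>_. 1) u v \<le> ereal n" if "u \<in> pverts H" "v \<in> pverts H" for u v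
    proof -
      have "\<mu> (\<lambda>_. 1) u v \<le> ereal (walk_dist u v)"
        using \<mu>_le_walk_dist assms(2) that by simp
      also have "\<dots> \<le> ereal n"
        using * that by simp
      finally show ?thesis .
    qed
    then have "diameter H \<le> ereal n"
      unfolding diameter_def by (intro SUP_least) auto
    then have "ereal (Suc n) \<le> ereal n" using assms(3) order_trans by blast
    then show False by simp
  qed
  then show thesis using that by (auto simp: not_le Suc_le_eq)
qed

theorem theorem3p1:
  fixes G :: "'a pair_pre_digraph"
  assumes "pair_graph G"
    and "connected (complement G)"
    and "diameter (complement G) \<ge> 4"
  shows "pc12 G \<le> 3"
proof -
  let ?H = "complement G"
  interpret G: pair_graph G by fact
  interpret H: pair_graph ?H using assms(1) by (rule pair_graph_complement)
  have verts: "pverts ?H = pverts G" by (simp add: complement_def)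
  have reach: "u \<rightarrow>\<^sup>*\<^bsub>with_proj ?H\<^esub> v" if "u \<in> pverts G" "v \<in> pverts G" for u v
  proof -
    \<comment> \<open>\<open>connected\<close> speaks of the symmetric closure, which has the same
      reachability as the already symmetric \<open>?H\<close>.\<close>
    have "u \<rightarrow>\<^sup>*\<^bsub>with_proj (mk_symmetric ?H)\<^esub> v"
      using assms(2) that by (auto simp: connected_def strongly_connected_def verts)
    then show ?thesis
      using H.reachable_mk_symmetric_eq H.sym_arcs by blast
  qed
  have "diameter ?H \<ge> ereal (Suc 3)"
    using assms(3) by simp
  then obtain x z where x: "x \<in> pverts G" and z: "z \<in> pverts G" "H.walk_dist x z \<ge> Suc 3"
    using diameter_ge_walk_dist[OF H.pair_wf_digraph, of 3] reach verts by metis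
  define L where "L v = min 4 (H.walk_dist x v)" for v
  have layer: "\<exists>u \<in> pverts G. L u = i" if "i \<le> 4" for i
  proof -
    have "i \<le> H.walk_dist x z" using that z by simp
    then obtain w where "w \<in> pverts G" "H.walk_dist x w = i"
      using H.walk_dist_intermediate[OF reach[OF x z(1)]] verts by auto
    then show ?thesis using that by (intro bexI[of _ w]) (auto simp: L_def)
  qed
  obtain a where a: "a \<in> pverts G" "L a = 1"
    using layer[of 1] by auto
  have "proper_connected_coloring G (layer_coloring L a)"
  proof (rule G.layer_coloring_proper_connected)
    fix u v assume uv: "u \<in> pverts G" "v \<in> pverts G"
    show "(u, v) \<in> parcs G" if "L u + 2 \<le> L v"
    proof (rule ccontr)
      assume "(u, v) \<notin> parcs G"
      then have "(u, v) \<in> parcs ?H"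
        using uv that by (auto simp: complement_def)
      \<comment> \<open>An arc of the complement raises the distance from \<open>x\<close> by at
        most one, and truncation at 4 preserves this bound.\<close>
      then have "H.walk_dist x v \<le> Suc (H.walk_dist x u)"
        using H.walk_dist_arc[OF reach[OF x uv(1)], of "(u, v)" v] by simp
      then show False using that by (simp add: L_def min_def split: if_splits)
    qed
    show "u = v" if "L u = 0" "L v = 0"
      using that H.walk_dist_eq_0[OF reach[OF x]] uv by (auto simp: L_def min_def split: if_splits)
  qed (use layer a in \<open>auto simp: L_def\<close>)
  moreover have "card (layer_coloring L a ` edge_set G) \<le> card {1::nat, 2, 3}"
    by (intro card_mono image_subsetI layer_coloring_range) simp
  ultimately have "pc12 G \<le> enat 3"
    by (intro pc12_le) auto
  then show ?thesis by (simp add: numeral_eq_enat)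
qed

end
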